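(* Let $n=2^k$ with $k\ge4$ an integer, and let $\mathbb{R}^n$ carry the Euclidean norm. Then $C(\mathbb{R}^n)=\log_2 n$.
   Context: For a finite-dimensional normed space $X$, $C(X)$ is the least constant such that $\mathcal{H}(A,\operatorname{Co}(A))\le C(X)\sup_{t\in[0,1]}\mathcal{H}(tA+(1-t)A,A)$ for all nonempty $A\subseteq X$; equivalently, $C(X)=\sup\{\mathcal{H}(A,\operatorname{Co}(A)): A\subseteq X \text{ approximately convex}\}$, where $A$ is approximately convex if $d(tx+(1-t)y,A)\le1$ for all $x,y\in A$, $t\in[0,1]$. Here $d(x,A)=\inf_{a\in A}\|x-a\|$, $\mathcal{H}$ is the Hausdorff distance and $\operatorname{Co}$ the convex hull. *)

theory Defs
  imports "HOL-Analysis.Analysis"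
begin

text \<open>Hausdorff distance with values in the extended reals (may be infinite;
  the library's hausdist is 0 for unbounded sets, which is not what we want).\<close>
definition ehausdist :: "'a::metric_space set \<Rightarrow> 'a set \<Rightarrow> ereal" where
  "ehausdist A B =
     max (SUP a\<in>A. ereal (infdist a B)) (SUP b\<in>B. ereal (infdist b A))"

definition approx_convex :: "'a::real_normed_vector set \<Rightarrow> bool" where
  "approx_convex A \<longleftrightarrow>
     (\<forall>x\<in>A. \<forall>y\<in>A. \<forall>t\<in>{0..1::real}. infdist (t *\<^sub>R x + (1 - t) *\<^sub>R y) A \<le> 1)"

definition C_const :: "'a::real_normed_vector itself \<Rightarrow> ereal" where
  "C_const _ = (SUP A\<in>{A::'a set. A \<noteq> {} \<and> approx_convex A}. ehausdist A (convex hull A))"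

end

(* Upper bound: f(x) = infdist x A satisfies f(t x + (1-t) y) <= t f(x) + (1-t) f(y) + 1, so halving
   repeatedly gives f <= k on the convex hull of 2^k points of A. By Caratheodory a point of the
   hull of A lies in a simplex spanned by n + 1 points. The maximum of f over this simplex is either on
   a face, where n = 2^k points suffice, or at an interior point, where the Euclidean geometry forces
   the maximum to be less than 4.

   Lower bound: the Shannon entropy H (base 2) also satisfies H(t x + (1-t) y) <= t H(x) + (1-t) H(y) + 1.
   It vanishes at the vertices of the probability simplex and equals log 2 n at the barycenter, so the
   epigraph of H, stretched horizontally until the graph is flat near the barycenter, is an
   approximately convex set whose hull contains a point at distance log 2 n. *)

theory Submission
  imports Defs
begin

section \<open>Upper bound: growth of the distance function on convex hulls\<close>

lemma infdist_lessE:
  assumes "A \<noteq> {}" "infdist x A < r"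
  obtains a where "a \<in> A" "dist x a < r"
  using assms cINF_less_iff[of A "dist x" r] by (auto simp: infdist_notempty)

text \<open>Replacing \<open>x\<close> and \<open>y\<close> by almost nearest points of
  \<open>A\<close> moves the combination by at most the same combination of their distances;
  approximate convexity of \<open>A\<close> costs the remaining 1.\<close>

lemma infdist_approx_convex:
  fixes A :: "'a::real_normed_vector set"
  assumes A: "approx_convex A" "A \<noteq> {}" and t: "t \<in> {0..1}"
  shows "infdist (t *\<^sub>R x + (1 - t) *\<^sub>R y) A \<le> t * infdist x A + (1 - t) * infdist y A + 1"
proof (rule field_le_epsilon)
  fix e :: real assume e: "e > 0"
  obtain a where a: "a \<in> A" "dist x a < infdist x A + e"
    by (rule infdist_lessE[of A x "infdist x A + e"]) (use A e in auto)
  obtain b where b: "b \<in> A" "dist y b < infdist y A + e"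
    by (rule infdist_lessE[of A y "infdist y A + e"]) (use A e in auto)
  let ?p = "t *\<^sub>R x + (1 - t) *\<^sub>R y" and ?q = "t *\<^sub>R a + (1 - t) *\<^sub>R b"
  have "dist ?p ?q = norm (t *\<^sub>R (x - a) + (1 - t) *\<^sub>R (y - b))"
    by (simp add: dist_norm algebra_simps)
  also have "\<dots> \<le> t * dist x a + (1 - t) * dist y b"
    using t norm_triangle_ineq[of "t *\<^sub>R (x - a)" "(1 - t) *\<^sub>R (y - b)"] by (simp add: dist_norm)
  also have "\<dots> \<le> t * (infdist x A + e) + (1 - t) * (infdist y A + e)"
    using a b t by (intro add_mono mult_left_mono) auto
  also have "\<dots> = t * infdist x A + (1 - t) * infdist y A + e"
    by (simp add: algebra_simps)
  finally have "dist ?p ?q \<le> t * infdist x A + (1 - t) * infdist y A + e" .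
  moreover have "infdist ?q A \<le> 1"
    using A a b t by (simp add: approx_convex_def)
  ultimately show "infdist ?p A \<le> t * infdist x A + (1 - t) * infdist y A + 1 + e"
    using infdist_triangle[of ?p A ?q] by linarith
qed

text \<open>A point of the hull lies on a segment joining the hulls of two halves of
  \<open>S\<close>. Each halving costs 1, and \<open>k\<close> of them reach single points.\<close>

lemma approx_convex_fun_le_on_convex_hull:
  fixes f :: "'a::euclidean_space \<Rightarrow> real"
  assumes f: "\<And>x y t. t \<in> {0..1} \<Longrightarrow> f (t *\<^sub>R x + (1 - t) *\<^sub>R y) \<le> t * f x + (1 - t) * f y + 1"
  assumes "finite S" "card S \<le> 2 ^ k" "\<And>x. x \<in> S \<Longrightarrow> f x \<le> 0" "z \<in> convex hull S"
  shows "f z \<le> real k"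
  using assms(2-)
proof (induction k arbitrary: S z)
  case 0
  then have "card S \<le> 1" "S \<noteq> {}" by auto
  with \<open>finite S\<close> have "card S = 1"
    using card_gt_0_iff[of S] by linarith
  with 0 show ?case by (auto simp: card_1_singleton_iff)
next
  case (Suc k)
  show ?case
  proof (cases "card S \<le> 2 ^ k")
    case True
    with Suc.IH[of S z] Suc.prems show ?thesis by fastforce
  next
    case False
    then obtain T where T: "T \<subseteq> S" "card T = 2 ^ k" "finite T"
      using obtain_subset_with_card_n[of "2 ^ k" S] by auto
    have cd: "card (S - T) = card S - 2 ^ k"
      using T by (simp add: card_Diff_subset)
    have ne: "T \<noteq> {}" "S - T \<noteq> {}"
      using T False cd by auto
    have "z \<in> convex hull (convex hull T \<union> convex hull (S - T))"
      using Suc.prems(4) hull_mono[of S "convex hull T \<union> convex hull (S - T)" convex]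
        hull_subset[of T convex] hull_subset[of "S - T" convex] by blast
    then obtain u v x y where uv: "u \<ge> 0" "v \<ge> 0" "u + v = 1" "x \<in> convex hull T"
      "y \<in> convex hull (S - T)" "z = u *\<^sub>R x + v *\<^sub>R y"
      by (subst (asm) convex_hull_union_two) (use ne in auto)
    have x: "f x \<le> k" by (rule Suc.IH[of T]) (use T uv Suc.prems in auto)
    have y: "f y \<le> k" by (rule Suc.IH[of "S - T"]) (use cd T uv Suc.prems in auto)
    have v: "v = 1 - u" using uv by auto
    have "f z \<le> u * f x + v * f y + 1" using uv f[of u x y] by (simp add: v)
    also have "\<dots> \<le> u * k + v * k + 1"
      using x y uv by (intro add_mono mult_left_mono) auto
    also have "\<dots> = Suc k" by (simp add: v algebra_simps)
    finally show ?thesis .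
  qed
qed

section \<open>Upper bound: Euclidean geometry at an interior maximum\<close>

text \<open>\<open>A\<close> need not be closed, so in general the infimum is attained only in the
  closure, on which the distance to \<open>A\<close> still vanishes.\<close>

lemma nearest_point_in_closure:
  fixes A :: "'a::heine_borel set"
  assumes "A \<noteq> {}"
  obtains a where "a \<in> closure A" "dist x a = infdist x A"
proof -
  obtain a where a: "a \<in> closure A" "\<And>b. b \<in> closure A \<Longrightarrow> dist x a \<le> dist x b"
    using distance_attains_inf[of "closure A" x] assms by auto
  have "infdist x A \<le> dist x a"
    using infdist_triangle[of x A a] a(1) assms by (simp add: in_closure_iff_infdist_zero)
  moreover have "dist x a \<le> infdist x A"
    unfolding infdist_notempty[OF assms] using a closure_subset assms
    by (intro cINF_greatest) auto
  ultimately show thesis using that a by force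
qed

text \<open>If \<open>z\<close> were a maximum of the distance with value \<open>r\<close>, moving away from a nearest point
  \<open>a\<close> would meet a second point \<open>b\<close> at distance about \<open>r\<close>, with a nonacute angle between
  \<open>a - z\<close> and \<open>b - z\<close>. Their midpoint is then within about \<open>r / sqrt 2\<close> of \<open>z\<close>, yet at least
  \<open>r - 1\<close> away from it; this is where \<open>r \<ge> 4\<close>, hence \<open>k \<ge> 4\<close>, is needed.\<close>

lemma infdist_no_interior_maximum:
  fixes A :: "'a::euclidean_space set"
  assumes A: "approx_convex A" "A \<noteq> {}" and z: "z \<in> interior K" and r: "infdist z A \<ge> 4"
  shows "\<exists>w\<in>K. infdist w A > infdist z A"
proof (rule ccontr)
  assume "\<not> ?thesis"
  then have max: "\<And>w. w \<in> K \<Longrightarrow> infdist w A \<le> infdist z A" by force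
  define r where "r = infdist z A"
  have r4: "r \<ge> 4" using r by (simp add: r_def)
  obtain a where a: "a \<in> closure A" "dist z a = r"
    using nearest_point_in_closure[OF A(2)] unfolding r_def by metis
  obtain d where d: "d > 0" "ball z d \<subseteq> K"
    using z by (auto simp: mem_interior)
  \<comment> \<open>The second bound keeps \<open>w\<close> inside \<open>K\<close>. The first makes
    \<open>(1 + e)^2 + 1\<close> smaller than 9/4, the factor that
    \<open>r - 1 \<ge> 3/4 * r\<close> produces at the end.\<close>
  define e where "e = min (1/25) (d / (2 * r))"
  have e: "e > 0" "e \<le> 1/25" "e * r < d"
  proof -
    have "e * r \<le> d / (2 * r) * r" using r4 by (intro mult_right_mono) (auto simp: e_def)
    then show "e * r < d" using d r4 by simp
  qed (use d r4 in \<open>auto simp: e_def\<close>)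
  define v where "v = z - a"
  define w where "w = z + e *\<^sub>R v"
  have nv: "norm v = r" using a by (simp add: v_def dist_norm)
  have zw: "dist z w = e * r" using e nv by (simp add: w_def dist_norm)
  have "w \<in> K" using d e zw by (auto simp: mem_ball)
  then have wr: "infdist w A \<le> r" using max by (simp add: r_def)
  obtain b where b: "b \<in> closure A" "dist w b = infdist w A"
    using nearest_point_in_closure[OF A(2)] by metis
  have ab0: "infdist a A = 0" "infdist b A = 0"
    using a b A(2) by (simp_all add: in_closure_iff_infdist_zero)
  define c where "c = b - z"
  have c1: "r \<le> norm c"
    using infdist_triangle[of z A b] ab0 by (simp add: r_def c_def dist_norm norm_minus_commute)
  have c2: "norm c \<le> r + e * r"
    using dist_triangle[of z b w] zw b wr by (simp add: c_def dist_norm norm_minus_commute)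
  have "norm (c - e *\<^sub>R v) = dist w b"
    by (simp add: c_def w_def dist_norm norm_minus_commute algebra_simps)
  \<comment> \<open>The step from \<open>z\<close> to \<open>w\<close> along \<open>v\<close> does
    not increase the distance to \<open>b\<close>, which is at most \<open>r\<close> from
    \<open>w\<close> and at least \<open>r\<close> from \<open>z\<close>. Expanding the squares then
    gives the sign of \<open>c \<bullet> v\<close>.\<close>
  then have "norm (c - e *\<^sub>R v) \<le> norm c" using b wr c1 by linarith
  then have "(norm (c - e *\<^sub>R v))\<^sup>2 \<le> (norm c)\<^sup>2" by (intro power_mono) auto
  then have "e * (e * (v \<bullet> v)) \<le> e * (2 * (c \<bullet> v))"
    by (simp add: power2_norm_eq_inner inner_diff inner_commute algebra_simps)
  then have "e * (v \<bullet> v) \<le> 2 * (c \<bullet> v)" using e by simp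
  then have cv: "c \<bullet> v \<ge> 0"
    using e mult_nonneg_nonneg[of e "v \<bullet> v"] by (simp del: mult_nonneg_nonneg)
  define m where "m = (1/2) *\<^sub>R a + (1 - 1/2) *\<^sub>R b"
  have "infdist m A \<le> 1"
    using infdist_approx_convex[OF A, of "1/2" a b] ab0 by (simp add: m_def)
  then have "r - 1 \<le> dist z m"
    using infdist_triangle[of z A m] by (simp add: r_def)
  also have "dist z m = norm (c - v) / 2"
  proof -
    have "m - z = (1/2) *\<^sub>R (c - v)"
      by (simp add: m_def c_def v_def algebra_simps flip: scaleR_2)
    then show ?thesis by (simp add: dist_norm norm_minus_commute[of z m])
  qed
  finally have "(2 * (r - 1))\<^sup>2 \<le> (norm (c - v))\<^sup>2" using r4 by (intro power_mono) auto
  also have "\<dots> \<le> (norm c)\<^sup>2 + r\<^sup>2"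
    using cv nv by (simp add: power2_norm_eq_inner inner_diff inner_commute flip: nv)
  also have "\<dots> \<le> (r + e * r)\<^sup>2 + r\<^sup>2"
    using c2 by (intro add_right_mono power_mono) auto
  also have "\<dots> \<le> (r + 1/25 * r)\<^sup>2 + r\<^sup>2"
    using e r4 by (intro add_right_mono power_mono add_left_mono mult_right_mono) auto
  also have "\<dots> = 2.0816 * r\<^sup>2" by (simp add: power2_eq_square algebra_simps)
  also have "\<dots> \<le> 2.1 * r\<^sup>2" by (intro mult_right_mono) auto
  finally have "4 * (r - 1)\<^sup>2 \<le> 2.1 * r\<^sup>2" unfolding power_mult_distrib by simp
  moreover have "(3/4 * r)\<^sup>2 \<le> (r - 1)\<^sup>2" using r4 by (intro power_mono) auto
  moreover have "(3/4 * r)\<^sup>2 = 9/16 * r\<^sup>2" by (simp add: power_mult_distrib power_divide)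
  ultimately have "r\<^sup>2 \<le> 0" by linarith
  then show False using r4 by simp
qed

lemma infdist_convex_hull_le:
  fixes A :: "'a::euclidean_space set"
  assumes A: "approx_convex A" "A \<noteq> {}" and k: "k \<ge> 4" "DIM('a) \<le> 2 ^ k"
    and z: "z \<in> convex hull A"
  shows "infdist z A \<le> real k"
proof -
  have small: "infdist x A \<le> k" if "finite T" "T \<subseteq> A" "card T \<le> DIM('a)" "x \<in> convex hull T" for x T
    by (rule approx_convex_fun_le_on_convex_hull[where S = T])
       (use that k infdist_approx_convex[OF A] in auto)
  obtain S where S: "finite S" "S \<subseteq> A" "card S \<le> DIM('a) + 1" "z \<in> convex hull S"
    using z unfolding caratheodory[of A] by auto
  let ?K = "convex hull S"
  have cK: "compact ?K" using S by (simp add: finite_imp_compact_convex_hull)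
  obtain x where x: "x \<in> ?K" "\<And>y. y \<in> ?K \<Longrightarrow> infdist y A \<le> infdist x A"
  proof -
    have "continuous_on ?K (\<lambda>x. infdist x A)" by (intro continuous_intros)
    then show thesis using continuous_attains_sup[OF cK] S(4) that by blast
  qed
  have "infdist x A \<le> k"
  proof (cases "x \<in> interior ?K")
    case True
    have "infdist x A < 4"
      using infdist_no_interior_maximum[OF A True] x(2) by force
    then show ?thesis using k by simp
  next
    case False
    show ?thesis
    \<comment> \<open>Caratheodory may give one point too many for \<open>small\<close>. In that
      case the frontier is covered by the hulls of \<open>S\<close> with one point removed, even if
      \<open>S\<close> is affinely dependent.\<close>
    proof (cases "card S = DIM('a) + 1")
      case True
      have "x \<in> frontier ?K"
        using False x(1) cK by (simp add: frontier_def compact_imp_closed closure_closed)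
      then obtain a where "a \<in> S" "x \<in> convex hull (S - {a})"
        using frontier_of_convex_hull[of S] True by auto
      then show ?thesis using S True by (intro small[of "S - {a}"]) auto
    next
      case False
      then show ?thesis using S x by (intro small[of S]) auto
    qed
  qed
  with x(2)[OF S(4)] show ?thesis by linarith
qed

lemma C_const_le:
  assumes "k \<ge> 4" "DIM('a::euclidean_space) \<le> 2 ^ k"
  shows "C_const TYPE('a) \<le> ereal (real k)"
  unfolding C_const_def ehausdist_def
proof (intro SUP_least max.boundedI; clarify)
  fix A :: "'a set" and a assume "a \<in> A"
  then have "a \<in> convex hull A" by (simp add: hull_inc)
  then show "ereal (infdist a (convex hull A)) \<le> ereal (real k)" by simp
next
  fix A :: "'a set" and z assume "A \<noteq> {}" "approx_convex A" "z \<in> convex hull A"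
  then show "ereal (infdist z A) \<le> ereal (real k)"
    using infdist_convex_hull_le assms by auto
qed

section \<open>Lower bound: Shannon entropy on the probability simplex\<close>

definition prob_simplex :: "(real ^ 'n) set" where
  "prob_simplex = {x. (\<forall>i. 0 \<le> x $ i) \<and> (\<Sum>i\<in>UNIV. x $ i) = 1}"

text \<open>The factor \<open>x $ i\<close> makes the terms at zero coordinates vanish, as in the
  usual convention for 0 log 0.\<close>

definition shannon_entropy :: "real ^ 'n \<Rightarrow> real" where
  "shannon_entropy x = (\<Sum>i\<in>UNIV. - (x $ i * log 2 (x $ i)))"

lemma mult_log_superadditive:
  fixes a b :: real
  assumes "a \<ge> 0" "b \<ge> 0"
  shows "a * log 2 a + b * log 2 b \<le> (a + b) * log 2 (a + b)"
proof -
  have "u * log 2 u \<le> u * log 2 (a + b)" if "0 \<le> u" "u \<le> a + b" for u :: real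
    by (cases "u = 0") (use that in \<open>auto intro!: mult_left_mono\<close>)
  from this[of a] this[of b] show ?thesis
    using assms by (simp add: algebra_simps)
qed

lemma mult_log_mult:
  fixes a b :: real
  assumes "a \<ge> 0" "b \<ge> 0"
  shows "(a * b) * log 2 (a * b) = a * (b * log 2 b) + b * (a * log 2 a)"
  by (cases "a = 0 \<or> b = 0") (use assms in \<open>auto simp: log_mult algebra_simps\<close>)

lemma binary_entropy_le_1:
  fixes t :: real
  assumes "t \<in> {0..1}"
  shows "- (t * log 2 t) - (1 - t) * log 2 (1 - t) \<le> 1"
proof -
  \<comment> \<open>The right side is the tangent line at \<open>u = 1/2\<close>; its values at
    \<open>t\<close> and \<open>1 - t\<close> add up to \<open>ln 2\<close>.\<close>
  have *: "- (u * ln u) \<le> 1/2 - u + u * ln 2" if "u \<ge> 0" for u :: real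
  proof (cases "u = 0")
    case False
    with that have u: "u > 0" by simp
    have "ln (1 / (2 * u)) \<le> 1 / (2 * u) - 1" using u by (intro ln_le_minus_one) auto
    then have "u * ln (1 / (2 * u)) \<le> u * (1 / (2 * u) - 1)" using u by (intro mult_left_mono) auto
    then show ?thesis using u by (simp add: ln_div ln_mult algebra_simps)
  qed simp
  have "- (t * ln t) - (1 - t) * ln (1 - t) \<le> ln 2"
    using *[of t] *[of "1 - t"] assms by (simp add: algebra_simps)
  then have "(- (t * ln t) - (1 - t) * ln (1 - t)) / ln 2 \<le> 1" by simp
  then show ?thesis by (simp add: log_def diff_divide_distrib)
qed

text \<open>In each coordinate, subadditivity of \<open>?\<eta>\<close> separates the two summands
  and its product rule pulls out \<open>t\<close> and \<open>1 - t\<close>. Since coordinates sum to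
  1, the extra terms add up to the binary entropy of \<open>t\<close>.\<close>

lemma shannon_entropy_approx_convex:
  assumes x: "x \<in> prob_simplex" and y: "y \<in> prob_simplex" and t: "t \<in> {0..1}"
  shows "shannon_entropy (t *\<^sub>R x + (1 - t) *\<^sub>R y)
    \<le> t * shannon_entropy x + (1 - t) * shannon_entropy y + 1"
proof -
  let ?\<eta> = "\<lambda>u::real. - (u * log 2 u)"
  have "shannon_entropy (t *\<^sub>R x + (1 - t) *\<^sub>R y)
    \<le> (\<Sum>i\<in>UNIV. (t * ?\<eta> (x $ i) + (1 - t) * ?\<eta> (y $ i)) + (x $ i * ?\<eta> t + y $ i * ?\<eta> (1 - t)))"
    unfolding shannon_entropy_def
  proof (rule sum_mono)
    fix i
    have "x $ i \<ge> 0" "y $ i \<ge> 0" using x y by (auto simp: prob_simplex_def)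
    then show "?\<eta> ((t *\<^sub>R x + (1 - t) *\<^sub>R y) $ i) \<le>
      (t * ?\<eta> (x $ i) + (1 - t) * ?\<eta> (y $ i)) + (x $ i * ?\<eta> t + y $ i * ?\<eta> (1 - t))"
      using mult_log_superadditive[of "t * x $ i" "(1 - t) * y $ i"]
        mult_log_mult[of t "x $ i"] mult_log_mult[of "1 - t" "y $ i"] t by simp
  qed
  also have "\<dots> = t * shannon_entropy x + (1 - t) * shannon_entropy y
      + ((\<Sum>i\<in>UNIV. x $ i) * ?\<eta> t + (\<Sum>i\<in>UNIV. y $ i) * ?\<eta> (1 - t))"
    unfolding shannon_entropy_def sum_distrib_left sum_distrib_right
    by (simp only: sum.distrib)
  also have "\<dots> \<le> t * shannon_entropy x + (1 - t) * shannon_entropy y + 1"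
    using binary_entropy_le_1[OF t] x y by (simp add: prob_simplex_def)
  finally show ?thesis .
qed

text \<open>Quadratic control near the barycenter, which later fixes how far to stretch the graph.
  It is \<open>ln u \<le> u - 1\<close> at \<open>u = n * x $ i\<close>, weighted by
  \<open>x $ i\<close> and summed.\<close>

lemma shannon_entropy_ge:
  fixes x :: "real ^ 'n"
  assumes "x \<in> prob_simplex"
  defines "n \<equiv> real CARD('n)"
  shows "log 2 n - n / ln 2 * (norm (x - (\<chi> i. 1 / n)))\<^sup>2 \<le> shannon_entropy x"
proof -
  have n: "n > 0" by (simp add: n_def)
  have x: "x $ i \<ge> 0" "(\<Sum>i\<in>UNIV. x $ i) = 1" for i
    using assms by (auto simp: prob_simplex_def)
  have "(norm (x - (\<chi> i. 1 / n)))\<^sup>2 = (\<Sum>i\<in>UNIV. (x $ i)\<^sup>2 - 2 / n * (x $ i) + (1 / n)\<^sup>2)"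
    unfolding power2_norm_eq_inner inner_vec_def
    by (intro sum.cong) (auto simp: power2_eq_square algebra_simps)
  also have "\<dots> = (\<Sum>i\<in>UNIV. (x $ i)\<^sup>2) - 2 / n + n * (1 / n)\<^sup>2"
    unfolding sum.distrib sum_subtractf by (simp only: x flip: sum_distrib_left) (simp add: n_def)
  finally have "n * (norm (x - (\<chi> i. 1 / n)))\<^sup>2 = n * (\<Sum>i\<in>UNIV. (x $ i)\<^sup>2) - 1"
    using n by (simp add: power2_eq_square field_simps)
  then have "ln n - n * (norm (x - (\<chi> i. 1 / n)))\<^sup>2
      = (\<Sum>i\<in>UNIV. ln n * x $ i - n * (x $ i)\<^sup>2 + x $ i)"
    by (simp add: sum.distrib sum_subtractf x flip: sum_distrib_left)
  also have "\<dots> \<le> (\<Sum>i\<in>UNIV. - (x $ i * ln (x $ i)))"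
  proof (rule sum_mono)
    fix i
    show "ln n * x $ i - n * (x $ i)\<^sup>2 + x $ i \<le> - (x $ i * ln (x $ i))"
    proof (cases "x $ i = 0")
      case False
      then have i: "x $ i > 0" using x(1)[of i] by simp
      then have "x $ i * ln (n * x $ i) \<le> x $ i * (n * x $ i - 1)"
        using n by (intro mult_left_mono ln_le_minus_one) auto
      then show ?thesis using i n by (simp add: ln_mult power2_eq_square algebra_simps)
    qed simp
  qed
  finally have "(ln n - n * (norm (x - (\<chi> i. 1 / n)))\<^sup>2) / ln 2
      \<le> (\<Sum>i\<in>UNIV. - (x $ i * ln (x $ i))) / ln 2"
    by (intro divide_right_mono) auto
  then show ?thesis
    by (simp add: shannon_entropy_def log_def diff_divide_distrib sum_divide_distrib)
qed

section \<open>Lower bound: the stretched epigraph of entropy\<close>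

lemma C_const_ge: "ereal (log 2 (real CARD('n))) \<le> C_const TYPE(real ^ 'n)"
proof -
  define n where "n = real CARD('n)"
  have n: "n \<ge> 1" by (simp add: n_def Suc_leI)
  define L where "L = log 2 n"
  define c where "c = n / ln 2"
  \<comment> \<open>The square of \<open>M\<close> is exactly the coefficient of the squared
    distance to \<open>b\<close> in the final estimate.\<close>
  define M where "M = sqrt (2 * L * c)"
  \<comment> \<open>The simplex lies in a hyperplane with unit normal \<open>e\<close>, so heights
    are measured along \<open>e\<close> and the epigraph fits into the same space.\<close>
  define e :: "real ^ 'n" where "e = (\<chi> i. 1 / sqrt n)"
  define b :: "real ^ 'n" where "b = (\<chi> i. 1 / n)"
  define A where "A = {M *\<^sub>R x + s *\<^sub>R e | x s. x \<in> prob_simplex \<and> shannon_entropy x \<le> s}"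
  have L: "L \<ge> 0" and c: "c > 0" using n by (auto simp: L_def c_def)
  have M: "M\<^sup>2 = 2 * L * c" using L c by (simp add: M_def)
  have e: "e \<bullet> e = 1"
    using n by (simp add: e_def inner_vec_def flip: n_def)
  have vert: "M *\<^sub>R axis j 1 \<in> A" for j
  proof -
    have "shannon_entropy (axis j 1 :: real ^ 'n) = 0"
      unfolding shannon_entropy_def by (intro sum.neutral) (auto simp: axis_def)
    moreover have "(axis j 1 :: real ^ 'n) \<in> prob_simplex"
      by (auto simp: prob_simplex_def axis_def)
    ultimately show ?thesis
      unfolding A_def by (intro CollectI exI[of _ "axis j 1"] exI[of _ 0]) auto
  qed
  then have ne: "A \<noteq> {}" by blast
  have "approx_convex A"
    unfolding approx_convex_def
  proof (intro ballI)
    fix p q and t :: real assume "p \<in> A" "q \<in> A" and t: "t \<in> {0..1}"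
    then obtain x s y r where
      x: "p = M *\<^sub>R x + s *\<^sub>R e" "x \<in> prob_simplex" "shannon_entropy x \<le> s" and
      y: "q = M *\<^sub>R y + r *\<^sub>R e" "y \<in> prob_simplex" "shannon_entropy y \<le> r"
      by (auto simp: A_def)
    define z where "z = t *\<^sub>R x + (1 - t) *\<^sub>R y"
    define h where "h = t * s + (1 - t) * r"
    have "z \<in> prob_simplex"
      using x y t by (auto simp: prob_simplex_def z_def sum.distrib simp flip: sum_distrib_left)
    \<comment> \<open>The entropy at \<open>z\<close> exceeds the mixed height \<open>h\<close> by
      at most 1, so raising the point by one unit vector \<open>e\<close> reaches
      \<open>A\<close>.\<close>
    then have "M *\<^sub>R z + (h + 1) *\<^sub>R e \<in> A"
    proof -
      have "t * shannon_entropy x + (1 - t) * shannon_entropy y \<le> h"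
        unfolding h_def using t x y by (intro add_mono mult_left_mono) auto
      then have "shannon_entropy z \<le> h + 1"
        using shannon_entropy_approx_convex[OF x(2) y(2) t] by (simp add: z_def)
      then show ?thesis using \<open>z \<in> prob_simplex\<close> by (auto simp: A_def)
    qed
    moreover have "t *\<^sub>R p + (1 - t) *\<^sub>R q = M *\<^sub>R z + h *\<^sub>R e"
      by (simp add: x y z_def h_def algebra_simps)
    moreover have "dist (M *\<^sub>R z + h *\<^sub>R e) (M *\<^sub>R z + (h + 1) *\<^sub>R e) = 1"
      using e by (simp add: dist_norm algebra_simps norm_eq_1)
    ultimately show "infdist (t *\<^sub>R p + (1 - t) *\<^sub>R q) A \<le> 1"
      using infdist_le[of _ A] by metis
  qed
  \<comment> \<open>The vertices have entropy 0, so their average, the barycenter at height 0, lies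
    in the hull.\<close>
  moreover have "M *\<^sub>R b \<in> convex hull A"
  proof -
    have "(\<Sum>j\<in>UNIV. (1 / n) *\<^sub>R (M *\<^sub>R (axis j 1 :: real ^ 'n))) \<in> convex hull A"
      by (intro convex_sum) (use vert hull_inc[of _ A convex] n in \<open>auto simp: n_def\<close>)
    also have "(\<Sum>j\<in>UNIV. (1 / n) *\<^sub>R (M *\<^sub>R (axis j 1 :: real ^ 'n))) = M *\<^sub>R b"
      by (simp add: vec_eq_iff b_def axis_def if_distrib cong: if_cong)
    finally show ?thesis .
  qed
  moreover have "L \<le> infdist (M *\<^sub>R b) A"
    unfolding infdist_notempty[OF ne]
  proof (intro cINF_greatest[OF ne])
    fix p assume "p \<in> A"
    then obtain x s where x: "p = M *\<^sub>R x + s *\<^sub>R e" "x \<in> prob_simplex" "shannon_entropy x \<le> s"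
      by (auto simp: A_def)
    have "(x - b) \<bullet> e = ((\<Sum>i\<in>UNIV. x $ i) - n * (1 / n)) / sqrt n"
      by (simp add: e_def b_def inner_vec_def sum_subtractf flip: sum_divide_distrib n_def)
    then have orth: "(x - b) \<bullet> e = 0" using x n by (simp add: prob_simplex_def)
    have "L - c * (norm (x - b))\<^sup>2 \<le> s"
      using shannon_entropy_ge[OF x(2)] x(3) by (simp add: L_def c_def b_def n_def)
    then have "2 * L * (L - c * (norm (x - b))\<^sup>2) \<le> 2 * L * s"
      using L by (intro mult_left_mono) auto
    \<comment> \<open>This is \<open>s^2 \<ge> 2 * L * s - L^2\<close>, which turns the lower bound
      on \<open>s\<close> into one on its square without a case split on signs.\<close>
    moreover have "0 \<le> (s - L)\<^sup>2" by simp
    ultimately have "L\<^sup>2 \<le> M\<^sup>2 * (norm (x - b))\<^sup>2 + s\<^sup>2"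
      unfolding M by (simp add: power2_eq_square algebra_simps)
    also have "\<dots> = (norm (M *\<^sub>R (x - b) + s *\<^sub>R e))\<^sup>2"
      using orth e unfolding power2_norm_eq_inner
      by (simp add: inner_add_left inner_add_right inner_commute power2_eq_square)
    also have "norm (M *\<^sub>R (x - b) + s *\<^sub>R e) = dist (M *\<^sub>R b) p"
      by (simp add: x dist_norm norm_minus_commute algebra_simps)
    finally show "L \<le> dist (M *\<^sub>R b) p" by (rule power2_le_imp_le) simp
  qed
  ultimately show ?thesis
    unfolding C_const_def ehausdist_def L_def n_def
    by (intro SUP_upper2[of A] max.coboundedI2 SUP_upper2[of "M *\<^sub>R b"]) (use ne in auto)
qed

theorem theorem3p2:
  fixes k :: nat
  assumes "k \<ge> 4" and "CARD('n::finite) = 2 ^ k"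
  shows "C_const TYPE(real ^ 'n) = ereal (log 2 (real CARD('n)))"
proof (rule antisym)
  have "C_const TYPE(real ^ 'n) \<le> ereal (real k)"
    using assms by (intro C_const_le) auto
  also have "real k = log 2 (real CARD('n))"
    using assms by simp
  finally show "C_const TYPE(real ^ 'n) \<le> ereal (log 2 (real CARD('n)))" .
qed (rule C_const_ge)

end
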